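(* Let $z$ be the map given by the intersection points and the conformal centers of the circles of a hexagonal circle pattern with constant angles $\alpha_n$, $n=1,2,3$, and write $z_{k,\ell,m}$ for its value at $k+\ell\omega+m\omega^2$, $k,\ell,m\in\mathbb Z$, $|k+\ell+m|\le1$. Let $\delta_1,\delta_2,\delta_3$ satisfy $2\alpha_n\equiv\delta_{n+2}-\delta_{n+1}\pmod{2\pi}$ (indices $n\in\{1,2,3\}$ mod 3) and put $\Delta_n=e^{-i\delta_n}$. Then for all $k,\ell,m\in\mathbb Z$ with $k+\ell+m=0$: $$q(z_{k,\ell,m},z_{k+1,\ell,m},z_{k+1,\ell,m-1},z_{k,\ell,m-1})=\frac{\Delta_1}{\Delta_3},$$ $$q(z_{k,\ell,m},z_{k,\ell,m+1},z_{k,\ell-1,m+1},z_{k,\ell-1,m})=\frac{\Delta_3}{\Delta_2},$$ $$q(z_{k,\ell,m},z_{k,\ell+1,m},z_{k-1,\ell+1,m},z_{k-1,\ell,m})=\frac{\Delta_2}{\Delta_1}.$$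
   Context: Let $\omega=e^{2\pi i/3}$, $\varepsilon=e^{\pi i/3}$. Every point of the triangular lattice $\{k+\ell\omega+m\omega^2\}$ has a unique label $(k,\ell,m)\in\mathbb Z^3$ with $k+\ell+m\in\{-1,0,1\}$. The points with $k+\ell+m=0$ form the set $F$ of centers of the hexagons of the regular hexagonal lattice, those with $k+\ell+m=\pm1$ form its vertex set $V$; edges of the hexagonal lattice are pairs of points of $V$ at distance 1, divided into classes $E^H_1,E^H_2,E^H_3$ according to whether the endpoints differ by $\pm1,\pm\omega,\pm\omega^2$. A map $w:V\to\hat{\mathbb C}$ is a hexagonal circle pattern if for each $\mathfrak z'\in F$ the points $w(\mathfrak z'+\varepsilon^k)$, $k=1,\dots,6$, lie on a circle $C(\mathfrak z')$ in this circular order. Orient $C(\mathfrak z')$ by this order. If hexagons centered at $\mathfrak z',\mathfrak z''$ share the edge $[\mathfrak z_k,\mathfrak z_{k+1}]$, $\mathfrak z_k=\mathfrak z'+\varepsilon^k$, the intersection angle $\phi\in[0,2\pi)$ of $C(\mathfrak z'),C(\mathfrak z'')$ is given by $e^{i\phi}=-t''/t'$, with $t',t''$ the unit tangents of the oriented circles at $w(\mathfrak z_k)$ (after a Möbius transformation if this point is $\infty$); so $\phi=0$ is external tangency. The pattern has constant angles $\alpha_1,\alpha_2,\alpha_3$ ($0\le\alpha_n<\pi$, $\alpha_1+\alpha_2+\alpha_3=\pi$) if $\phi=\alpha_n$ on $E^H_n$. Fix $P_\infty\in\hat{\mathbb C}$; the conformal center of a circle is the reflection of $P_\infty$ in it.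 The extended map $z$ equals $w$ on $V$ and assigns to $\mathfrak z'\in F$ the conformal center of $C(\mathfrak z')$. Cross-ratio: $q(z_1,z_2,z_3,z_4)=\dfrac{(z_2-z_1)(z_4-z_3)}{(z_3-z_2)(z_1-z_4)}$ (quadrilaterals for which it is undefined are excluded). *)

theory Defs
  imports "HOL-Analysis.Analysis" "HOL-Library.Real_Mod"
begin

section \<open>The Riemann sphere, Moebius transformations and the cross-ratio\<close>

datatype riemann_sphere = Pt (the_Pt: complex) | Infty

fun moebius :: "complex \<Rightarrow> complex \<Rightarrow> complex \<Rightarrow> complex \<Rightarrow> riemann_sphere \<Rightarrow> riemann_sphere" where
  "moebius a b c d (Pt z) = (if c * z + d = 0 then Infty else Pt ((a * z + b) / (c * z + d)))"
| "moebius a b c d Infty = (if c = 0 then Infty else Pt (a / c))"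

definition is_moebius :: "(riemann_sphere \<Rightarrow> riemann_sphere) \<Rightarrow> bool" where
  "is_moebius f \<longleftrightarrow> (\<exists>a b c d. a * d - b * c \<noteq> 0 \<and> f = moebius a b c d)"

text \<open>
  \<open>sphere_diff p q\<close> is the determinant \<open>p\<^sub>1 q\<^sub>2 - q\<^sub>1 p\<^sub>2\<close> of the homogeneous coordinates
  \<open>Pt z = [z : 1]\<close>, \<open>Infty = [1 : 0]\<close>. The cross-ratio is homogeneous of degree 0 in each
  argument, so replacing differences by these determinants gives its continuous extension
  to the sphere.
\<close>
fun sphere_diff :: "riemann_sphere \<Rightarrow> riemann_sphere \<Rightarrow> complex" where
  "sphere_diff (Pt z) (Pt w) = z - w"
| "sphere_diff Infty (Pt w) = 1"
| "sphere_diff (Pt z) Infty = -1"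
| "sphere_diff Infty Infty = 0"

definition cr_num :: "riemann_sphere \<Rightarrow> riemann_sphere \<Rightarrow> riemann_sphere \<Rightarrow> riemann_sphere \<Rightarrow> complex" where
  "cr_num z1 z2 z3 z4 = sphere_diff z2 z1 * sphere_diff z4 z3"

definition cr_den :: "riemann_sphere \<Rightarrow> riemann_sphere \<Rightarrow> riemann_sphere \<Rightarrow> riemann_sphere \<Rightarrow> complex" where
  "cr_den z1 z2 z3 z4 = sphere_diff z3 z2 * sphere_diff z1 z4"

text \<open>The cross-ratio is undefined exactly if it has the form 0/0, i.e. if at least three of the
  four points coincide; otherwise it is a point of the sphere.\<close>
definition cross_ratio_defined ::
  "riemann_sphere \<Rightarrow> riemann_sphere \<Rightarrow> riemann_sphere \<Rightarrow> riemann_sphere \<Rightarrow> bool" where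
  "cross_ratio_defined z1 z2 z3 z4 \<longleftrightarrow> \<not> (cr_num z1 z2 z3 z4 = 0 \<and> cr_den z1 z2 z3 z4 = 0)"

definition cross_ratio ::
  "riemann_sphere \<Rightarrow> riemann_sphere \<Rightarrow> riemann_sphere \<Rightarrow> riemann_sphere \<Rightarrow> riemann_sphere" where
  "cross_ratio z1 z2 z3 z4 =
     (if cr_den z1 z2 z3 z4 = 0 then Infty else Pt (cr_num z1 z2 z3 z4 / cr_den z1 z2 z3 z4))"

lemma cross_ratio_Pt:
  assumes "z2 \<noteq> z3" "z4 \<noteq> z1"
  shows "cross_ratio (Pt z1) (Pt z2) (Pt z3) (Pt z4) =
    Pt ((z2 - z1) * (z4 - z3) / ((z3 - z2) * (z1 - z4)))"
  using assms by (auto simp: cross_ratio_def cr_num_def cr_den_def)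


section \<open>Oriented circles\<close>

text \<open>
  A circle on the sphere (Euclidean circle, or line with \<open>Infty\<close>) together with an orientation is
  represented by a Moebius transformation \<open>f\<close>: the circle is the image under \<open>f\<close> of the unit
  circle, oriented by the parametrization \<open>t \<mapsto> f (Pt (cis t))\<close>. Different \<open>f\<close> may represent the
  same oriented circle; the notions below depend only on the latter.
\<close>
definition circle_param :: "(riemann_sphere \<Rightarrow> riemann_sphere) \<Rightarrow> real \<Rightarrow> riemann_sphere" where
  "circle_param f t = f (Pt (cis t))"

text \<open>
  Consecutive points are allowed to coincide, because circles meeting at angle 0 (tangent circles)
  have only one common point.
\<close>
definition in_circular_order ::
  "(riemann_sphere \<Rightarrow> riemann_sphere) \<Rightarrow> (nat \<Rightarrow> riemann_sphere) \<Rightarrow> bool" where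
  "in_circular_order f p \<longleftrightarrow>
     (\<exists>t::nat \<Rightarrow> real. (\<forall>k\<in>{1..6}. p k = circle_param f (t k)) \<and>
        (\<forall>k\<in>{1..5}. t k \<le> t (Suc k)) \<and> t 6 \<le> t 1 + 2 * pi)"

definition unit_circle_reflection :: "riemann_sphere \<Rightarrow> riemann_sphere" where
  "unit_circle_reflection p =
     (case p of Infty \<Rightarrow> Pt 0 | Pt z \<Rightarrow> (if z = 0 then Infty else Pt (1 / cnj z)))"

definition circle_reflection ::
  "(riemann_sphere \<Rightarrow> riemann_sphere) \<Rightarrow> riemann_sphere \<Rightarrow> riemann_sphere" where
  "circle_reflection f p = f (unit_circle_reflection (inv f p))"

text \<open>A local coordinate at \<open>p\<close>: the identity if \<open>p\<close> is finite, \<open>1 / z\<close> if \<open>p\<close> is \<open>Infty\<close>.\<close>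
definition chart_at :: "riemann_sphere \<Rightarrow> riemann_sphere \<Rightarrow> complex" where
  "chart_at p q = (if p = Infty then the_Pt (moebius 0 1 1 0 q) else the_Pt q)"

text \<open>Meaningful only for points \<open>p\<close> on the circle.\<close>
definition unit_tangent :: "(riemann_sphere \<Rightarrow> riemann_sphere) \<Rightarrow> riemann_sphere \<Rightarrow> complex" where
  "unit_tangent f p =
     sgn (vector_derivative (\<lambda>t. chart_at p (circle_param f t)) (at (Arg2pi (the_Pt (inv f p)))))"

text \<open>The \<open>\<phi> \<in> {0..<2 * pi}\<close> with \<open>exp (\<i> * \<phi>) = - t'' / t'\<close>, where \<open>t'\<close> and \<open>t''\<close> are the
  unit tangents of \<open>f'\<close> and \<open>f''\<close> at \<open>p\<close>.\<close>
definition intersection_angle ::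
  "(riemann_sphere \<Rightarrow> riemann_sphere) \<Rightarrow> (riemann_sphere \<Rightarrow> riemann_sphere) \<Rightarrow> riemann_sphere \<Rightarrow> real" where
  "intersection_angle f' f'' p = Arg2pi (- unit_tangent f'' p / unit_tangent f' p)"


section \<open>The hexagonal lattice\<close>

definition omega3 :: complex where "omega3 = exp (2 * pi * \<i> / 3)"
definition eps6 :: complex where "eps6 = exp (pi * \<i> / 3)"

definition lattice_point :: "int \<Rightarrow> int \<Rightarrow> int \<Rightarrow> complex" where
  "lattice_point k l m = of_int k + of_int l * omega3 + of_int m * omega3 ^ 2"

definition hex_centers :: "complex set" where
  "hex_centers = {lattice_point k l m | k l m. k + l + m = 0}"

definition hex_vertices :: "complex set" where
  "hex_vertices = {lattice_point k l m | k l m. k + l + m = 1 \<or> k + l + m = -1}"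

definition hex_edges :: "complex set set" where
  "hex_edges = {{u, v} | u v. u \<in> hex_vertices \<and> v \<in> hex_vertices \<and> dist u v = 1}"

text \<open>For \<open>n \<in> {1, 2, 3}\<close>.\<close>
definition hex_edge_class :: "nat \<Rightarrow> complex set set" where
  "hex_edge_class n = {{u, v} | u v. {u, v} \<in> hex_edges \<and>
     (v - u = omega3 ^ (n - 1) \<or> v - u = - (omega3 ^ (n - 1)))}"

definition hexagon_edges :: "complex \<Rightarrow> complex set set" where
  "hexagon_edges c = {{c + eps6 ^ k, c + eps6 ^ Suc k} | k. k \<in> {1..6}}"


section \<open>Hexagonal circle patterns\<close>

text \<open>
  \<open>C c\<close> represents the circle of the hexagon centered at \<open>c\<close>, oriented by the circular order of
  the images of the vertices. If the six images take at most two values, they do not determine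
  \<open>C c\<close>, which is why \<open>C\<close> is made explicit; constant angles (see below) exclude this case.
\<close>
definition hexagonal_circle_pattern ::
  "(complex \<Rightarrow> riemann_sphere) \<Rightarrow> (complex \<Rightarrow> riemann_sphere \<Rightarrow> riemann_sphere) \<Rightarrow> bool" where
  "hexagonal_circle_pattern w C \<longleftrightarrow>
     (\<forall>c\<in>hex_centers. is_moebius (C c) \<and> in_circular_order (C c) (\<lambda>k. w (c + eps6 ^ k)))"

definition has_constant_angles ::
  "(complex \<Rightarrow> riemann_sphere) \<Rightarrow> (complex \<Rightarrow> riemann_sphere \<Rightarrow> riemann_sphere) \<Rightarrow> (nat \<Rightarrow> real) \<Rightarrow> bool" where
  "has_constant_angles w C \<alpha> \<longleftrightarrow>
     (\<forall>n\<in>{1, 2, 3}. 0 \<le> \<alpha> n \<and> \<alpha> n < pi) \<and> \<alpha> 1 + \<alpha> 2 + \<alpha> 3 = pi \<and>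
     (\<forall>c'\<in>hex_centers. \<forall>c''\<in>hex_centers. \<forall>k\<in>{1..6}. \<forall>n\<in>{1, 2, 3}.
        c' \<noteq> c'' \<longrightarrow>
        {c' + eps6 ^ k, c' + eps6 ^ Suc k} \<in> hexagon_edges c'' \<inter> hex_edge_class n \<longrightarrow>
        intersection_angle (C c') (C c'') (w (c' + eps6 ^ k)) = \<alpha> n)"

definition conformal_center ::
  "riemann_sphere \<Rightarrow> (riemann_sphere \<Rightarrow> riemann_sphere) \<Rightarrow> riemann_sphere" where
  "conformal_center P f = circle_reflection f P"

definition extended_map ::
  "riemann_sphere \<Rightarrow> (complex \<Rightarrow> riemann_sphere) \<Rightarrow> (complex \<Rightarrow> riemann_sphere \<Rightarrow> riemann_sphere) \<Rightarrow>
   complex \<Rightarrow> riemann_sphere" where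
  "extended_map P w C x = (if x \<in> hex_centers then conformal_center P (C x) else w x)"

end

theory Submission
  imports Defs
begin

text \<open>
  In the Euclidean case \<open>P = Infty\<close> the conformal centers are the ordinary centers, and the vector
  from a point of an oriented circle to the center is a constant multiple of the tangent there. The
  cross-ratio of two centers and two common points \<open>p\<close>, \<open>q\<close> of the circles is therefore
  a product of ratios of tangents, and these are what the intersection angles measure. The proof
  extends this to an arbitrary \<open>P\<close>: if \<open>z\<close> is the reflection of \<open>P\<close> in an oriented circle with
  unit tangents \<open>t\<^sub>p\<close>, then there is a constant \<open>\<mu> \<noteq> 0\<close> with
    \<open>sphere_diff z p = \<mu> * (\<plusminus> t\<^sub>p) * cnj (sphere_diff P p)\<close>
  for all \<open>p\<close> on the circle (lemma \<open>conformal_center_diff\<close>); here \<open>\<mu>\<close> depends only on the circle and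
  \<open>P\<close>, while the sign and the last factor depend only on \<open>p\<close> and \<open>P\<close>.

  In the cross-ratio of \<open>z'\<close>, \<open>p\<close>, \<open>z''\<close>, \<open>q\<close> each circle and each common point occurs once
  above and once below the fraction bar. Hence the constants, the signs and the factors containing
  \<open>P\<close> cancel, which leaves \<open>(t'\<^sub>p / t''\<^sub>p) * (t''\<^sub>q / t'\<^sub>q)\<close>. By the angle condition at \<open>p\<close>,
  the first point of the common edge as seen from \<open>z'\<close>, and at \<open>q\<close>, the first point as seen from
  \<open>z''\<close>, both factors equal \<open>- cis (- \<alpha>)\<close>, and the cross-ratio is \<open>cis (- 2 * \<alpha>)\<close>
  (lemma \<open>cross_ratio_intersecting_circles\<close>). This also covers the case \<open>p = q\<close>
  of touching circles, where the two conditions and \<open>0 \<le> \<alpha> < pi\<close> force \<open>\<alpha> = 0\<close> and the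
  cross-ratio is 1. The cancellation fails only for
  \<open>P = p\<close> or \<open>P = q\<close>; then both centers coincide with that point and the cross-ratio is
  undefined.
\<close>

section \<open>Moebius transformations in homogeneous coordinates\<close>

fun hom1 :: "riemann_sphere \<Rightarrow> complex" where
  "hom1 (Pt z) = z" | "hom1 Infty = 1"

fun hom2 :: "riemann_sphere \<Rightarrow> complex" where
  "hom2 (Pt z) = 1" | "hom2 Infty = 0"

lemma sphere_diff_hom: "sphere_diff p q = hom1 p * hom2 q - hom1 q * hom2 p"
  by (cases p; cases q) auto

lemma sphere_diff_eq_0_iff: "sphere_diff p q = 0 \<longleftrightarrow> p = q"
  by (cases p; cases q) auto

lemma sphere_diff_swap: "sphere_diff p q = - sphere_diff q p"
  by (simp add: sphere_diff_hom)

text \<open>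
  The matrix of a Moebius transformation maps the normalized coordinates of \<open>p\<close> to a multiple of
  the normalized coordinates of the image; this is the multiplier.
\<close>
definition hom_factor :: "complex \<Rightarrow> complex \<Rightarrow> complex \<Rightarrow> complex \<Rightarrow> riemann_sphere \<Rightarrow> complex" where
  "hom_factor a b c d p =
     (if moebius a b c d p = Infty then a * hom1 p + b * hom2 p else c * hom1 p + d * hom2 p)"

lemma hom_moebius:
  assumes "a * d - b * c \<noteq> 0"
  shows "hom_factor a b c d p \<noteq> 0"
    and "a * hom1 p + b * hom2 p = hom_factor a b c d p * hom1 (moebius a b c d p)"
    and "c * hom1 p + d * hom2 p = hom_factor a b c d p * hom2 (moebius a b c d p)"
proof -
  have "a * z + b \<noteq> 0" if "c * z + d = 0" for z
  proof
    assume "a * z + b = 0"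
    have "a * d - b * c = a * (c * z + d) - c * (a * z + b)" by (simp add: algebra_simps)
    with that \<open>a * z + b = 0\<close> assms show False by simp
  qed
  with assms show "hom_factor a b c d p \<noteq> 0"
    "a * hom1 p + b * hom2 p = hom_factor a b c d p * hom1 (moebius a b c d p)"
    "c * hom1 p + d * hom2 p = hom_factor a b c d p * hom2 (moebius a b c d p)"
    by (cases p; force simp: hom_factor_def split: if_splits)+
qed

text \<open>Multiplicativity of the determinant.\<close>
lemma sphere_diff_moebius:
  assumes "a * d - b * c \<noteq> 0"
  shows "hom_factor a b c d p * hom_factor a b c d q *
      sphere_diff (moebius a b c d p) (moebius a b c d q) = (a * d - b * c) * sphere_diff p q"
proof -
  let ?f = "moebius a b c d" and ?l = "hom_factor a b c d"
  have "?l p * ?l q * sphere_diff (?f p) (?f q) =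
      (?l p * hom1 (?f p)) * (?l q * hom2 (?f q)) - (?l q * hom1 (?f q)) * (?l p * hom2 (?f p))"
    by (simp add: sphere_diff_hom algebra_simps)
  also have "\<dots> = (a * d - b * c) * sphere_diff p q"
    by (simp add: hom_moebius(2,3)[OF assms, symmetric] sphere_diff_hom algebra_simps)
  finally show ?thesis .
qed

lemma inj_moebius:
  assumes "a * d - b * c \<noteq> 0"
  shows "inj (moebius a b c d)"
proof (rule injI)
  fix p q assume "moebius a b c d p = moebius a b c d q"
  then have "sphere_diff (moebius a b c d p) (moebius a b c d q) = 0"
    by (simp add: sphere_diff_eq_0_iff)
  with sphere_diff_moebius[OF assms, of p q] assms have "sphere_diff p q = 0" by simp
  then show "p = q" by (simp add: sphere_diff_eq_0_iff)
qed

lemma surj_moebius: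
  assumes "a * d - b * c \<noteq> 0"
  shows "surj (moebius a b c d)"
proof -
  \<comment> \<open>The adjugate matrix gives the inverse.\<close>
  have "moebius a b c d (moebius d (- b) (- c) a p) = p" for p
  proof -
    define q where "q = moebius d (- b) (- c) a p"
    define r where "r = moebius a b c d q"
    define x where "x = hom_factor d (- b) (- c) a p"
    define y where "y = hom_factor a b c d q"
    have D: "d * a - - b * - c \<noteq> 0" using assms by (simp add: mult.commute)
    note q = hom_moebius[OF D, of p, folded q_def x_def]
      and r = hom_moebius[OF assms, of q, folded r_def y_def]
    have "x * y * hom1 r = a * (x * hom1 q) + b * (x * hom2 q)"
      unfolding mult.assoc r(2)[symmetric] by (simp add: algebra_simps)
    also have "\<dots> = (a * d - b * c) * hom1 p"
      by (simp add: q(2,3)[symmetric] algebra_simps)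
    finally have 1: "x * y * hom1 r = (a * d - b * c) * hom1 p" .
    have "x * y * hom2 r = c * (x * hom1 q) + d * (x * hom2 q)"
      unfolding mult.assoc r(3)[symmetric] by (simp add: algebra_simps)
    also have "\<dots> = (a * d - b * c) * hom2 p"
      by (simp add: q(2,3)[symmetric] algebra_simps)
    finally have 2: "x * y * hom2 r = (a * d - b * c) * hom2 p" .
    have "x * y * sphere_diff r p = (x * y * hom1 r) * hom2 p - hom1 p * (x * y * hom2 r)"
      by (simp add: sphere_diff_hom algebra_simps)
    also have "\<dots> = 0" unfolding 1 2 by simp
    finally have "r = p" using q(1) r(1) by (simp add: sphere_diff_eq_0_iff)
    then show ?thesis by (simp only: r_def q_def)
  qed
  then show ?thesis by (metis surjI)
qed

section \<open>Tangents of oriented circles\<close>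

lemma has_vector_derivative_moebius_cis:
  assumes nz: "c * cis r + d \<noteq> 0"
    and g: "\<And>t. c * cis t + d \<noteq> 0 \<Longrightarrow> g t = (a * cis t + b) / (c * cis t + d)"
  shows "(g has_vector_derivative \<i> * (a * d - b * c) * cis r / (c * cis r + d)\<^sup>2) (at r)"
proof (rule has_vector_derivative_transform_within_open)
  have "(cis has_vector_derivative \<i> * cis r) (at r)"
    by (auto simp: cis_conv_exp has_vector_derivative_def intro!: derivative_eq_intros)
  moreover have "((\<lambda>z. (a * z + b) / (c * z + d)) has_field_derivative
      (a * d - b * c) / (c * cis r + d)\<^sup>2) (at (cis r))"
    using nz by (auto intro!: derivative_eq_intros simp: field_simps power2_eq_square)
  ultimately have "((\<lambda>z. (a * z + b) / (c * z + d)) \<circ> cis has_vector_derivative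
      \<i> * cis r * ((a * d - b * c) / (c * cis r + d)\<^sup>2)) (at r)"
    by (rule field_vector_diff_chain_at)
  then show "((\<lambda>t. (a * cis t + b) / (c * cis t + d)) has_vector_derivative
      \<i> * (a * d - b * c) * cis r / (c * cis r + d)\<^sup>2) (at r)"
    by (simp add: o_def mult_ac)
  show "open {t. c * cis t + d \<noteq> 0}"
    by (intro open_Collect_neq continuous_intros)
qed (use nz g in auto)

text \<open>
  The chart \<open>1 / z\<close> at \<open>Infty\<close> interchanges the two homogeneous coordinates and so changes the sign
  of the determinant of the transformation, hence of the tangent.
\<close>
definition chart_sign :: "riemann_sphere \<Rightarrow> complex" where
  "chart_sign p = (if p = Infty then - 1 else 1)"

lemma unit_tangent_moebius:
  assumes D: "a * d - b * c \<noteq> 0" and u: "cmod u = 1"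
  shows "unit_tangent (moebius a b c d) (moebius a b c d (Pt u)) =
    sgn (chart_sign (moebius a b c d (Pt u)) * \<i> * (a * d - b * c) * u / (hom_factor a b c d (Pt u))\<^sup>2)"
proof -
  let ?f = "moebius a b c d"
  let ?p = "?f (Pt u)"
  define r where "r = Arg2pi u"
  have cis_r: "cis r = u"
    using complex_norm_eq_1_exp[of u] u by (simp add: r_def cis_conv_exp)
  have "((\<lambda>t. chart_at ?p (circle_param ?f t)) has_vector_derivative
     (chart_sign ?p * \<i> * (a * d - b * c) * u / (hom_factor a b c d (Pt u))\<^sup>2)) (at r)"
  proof (cases "c * u + d = 0")
    case True
    have l: "hom_factor a b c d (Pt u) = a * u + b" using True by (simp add: hom_factor_def)
    have "a * cis r + b \<noteq> 0" using hom_moebius(1)[OF D, of "Pt u"] l cis_r by simp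
    from has_vector_derivative_moebius_cis[OF this,
        of "\<lambda>t. chart_at ?p (circle_param ?f t)" c d]
    have "((\<lambda>t. chart_at ?p (circle_param ?f t)) has_vector_derivative
       \<i> * (c * b - d * a) * u / (a * u + b)\<^sup>2) (at r)"
      using True by (simp add: chart_at_def circle_param_def cis_r)
    moreover have "\<i> * (c * b - d * a) * u = chart_sign ?p * \<i> * (a * d - b * c) * u"
      using True by (simp add: chart_sign_def algebra_simps)
    ultimately show ?thesis by (simp only: l)
  next
    case False
    then show ?thesis
      using has_vector_derivative_moebius_cis[of c r d "\<lambda>t. chart_at ?p (circle_param ?f t)" a b]
      by (simp add: cis_r chart_at_def circle_param_def chart_sign_def hom_factor_def)
  qed
  moreover have "inv ?f ?p = Pt u" by (rule inv_f_f[OF inj_moebius[OF D]])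
  ultimately show ?thesis
    by (simp add: unit_tangent_def r_def vector_derivative_at del: moebius.simps)
qed

lemma norm_unit_tangent:
  assumes "is_moebius f"
  shows "cmod (unit_tangent f (circle_param f t)) = 1"
proof -
  obtain a b c d where D: "a * d - b * c \<noteq> 0" and f: "f = moebius a b c d"
    using assms by (auto simp: is_moebius_def)
  show ?thesis
    using D hom_moebius(1)[OF D, of "Pt (cis t)"]
    by (simp add: f circle_param_def unit_tangent_moebius norm_sgn norm_divide chart_sign_def del: moebius.simps)
qed

section \<open>Conformal centers\<close>

text \<open>
  The point \<open>[x\<^sub>1 : x\<^sub>2]\<close> is reflected to \<open>[cnj x\<^sub>2 : cnj x\<^sub>1]\<close>; as \<open>cnj u = 1 / u\<close> on the unit
  circle, this turns the determinant with \<open>[u : 1]\<close> into \<open>- u\<close> times its conjugate.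
  The number \<open>\<nu>\<close> comes from normalizing the coordinates of the reflected point.
\<close>
lemma sphere_diff_unit_circle_reflection:
  obtains \<nu> where "\<nu> \<noteq> 0"
    "\<And>u. cmod u = 1 \<Longrightarrow>
      sphere_diff (unit_circle_reflection x) (Pt u) = \<nu> * u * cnj (sphere_diff x (Pt u))"
proof -
  define \<nu> where "\<nu> = (case x of Infty \<Rightarrow> - 1 | Pt z \<Rightarrow> if z = 0 then - 1 else - 1 / cnj z)"
  have "\<nu> \<noteq> 0" by (auto simp: \<nu>_def split: riemann_sphere.split)
  moreover have "sphere_diff (unit_circle_reflection x) (Pt u) = \<nu> * u * cnj (sphere_diff x (Pt u))"
    if "cmod u = 1" for u
  proof -
    have "u * cnj u = 1" using that by (simp add: complex_norm_square[symmetric])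
    then show ?thesis
      by (cases x) (auto simp: \<nu>_def unit_circle_reflection_def field_simps)
  qed
  ultimately show ?thesis using that by blast
qed

text \<open>
  The identity for the unit circle is transported by the transformation that parametrizes the circle.
  If \<open>u\<close> is the parameter of \<open>p\<close>, this produces the multiplier \<open>h\<close> at \<open>u\<close> on one side and its
  conjugate on the other, so that \<open>u\<close> becomes \<open>u * cnj h / h\<close>. That is the direction of
  \<open>u / h\<^sup>2\<close>, to which the derivative of the parametrization is proportional.
\<close>
lemma conformal_center_diff:
  assumes "is_moebius f"
  obtains \<mu> where "\<mu> \<noteq> 0"
    "\<And>t p. p = circle_param f t \<Longrightarrow>
      sphere_diff (conformal_center P f) p =
        \<mu> * (chart_sign p * unit_tangent f p) * cnj (sphere_diff P p)"
proof -
  obtain a b c d where D: "a * d - b * c \<noteq> 0" and f: "f = moebius a b c d"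
    using assms by (auto simp: is_moebius_def)
  define D' where "D' = a * d - b * c"
  let ?l = "hom_factor a b c d"
  define x where "x = inv f P"
  define x' where "x' = unit_circle_reflection x"
  have P: "P = f x" using surj_moebius[OF D] by (simp add: x_def f surj_f_inv_f)
  have z: "conformal_center P f = f x'"
    by (simp add: conformal_center_def circle_reflection_def x_def x'_def)
  obtain \<nu> where \<nu>: "\<nu> \<noteq> 0"
    "\<And>u. cmod u = 1 \<Longrightarrow> sphere_diff x' (Pt u) = \<nu> * u * cnj (sphere_diff x (Pt u))"
    using sphere_diff_unit_circle_reflection[of x] unfolding x'_def by metis
  have nz: "?l y \<noteq> 0" for y using hom_moebius(1)[OF D] .
  have D'_nz: "D' \<noteq> 0" using D by (simp add: D'_def)
  define \<mu> where "\<mu> = D' * \<nu> * cnj (?l x) / (cnj D' * ?l x' * \<i> * sgn D')"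
  have "\<mu> \<noteq> 0" using \<nu>(1) nz D'_nz by (simp add: \<mu>_def sgn_zero_iff)
  moreover have "sphere_diff (conformal_center P f) p =
        \<mu> * (chart_sign p * unit_tangent f p) * cnj (sphere_diff P p)"
    if p: "p = circle_param f t" for t p
  proof -
    define u where "u = cis t"
    have u: "cmod u = 1" by (simp add: u_def)
    have p: "p = f (Pt u)" using p by (simp add: circle_param_def u_def)
    define h where "h = ?l (Pt u)"
    have h_nz: "h \<noteq> 0" using nz by (simp add: h_def)
    have "sgn (u / h\<^sup>2) = u * cnj h / h"
    proof -
      have "sgn (u / h\<^sup>2) = (u / h\<^sup>2) * of_real ((cmod h)\<^sup>2)"
        using u by (simp add: sgn_eq norm_divide norm_power)
      also have "\<dots> = u * cnj h / h"
        using h_nz unfolding complex_norm_square by (simp add: field_simps power2_eq_square)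
      finally show ?thesis .
    qed
    moreover have "unit_tangent f p = chart_sign p * (\<i> * (sgn D' * sgn (u / h\<^sup>2)))"
    proof -
      have "unit_tangent f p = sgn (chart_sign p * (\<i> * (D' * (u / h\<^sup>2))))"
        using unit_tangent_moebius[OF D u] by (simp add: f p D'_def h_def mult_ac del: moebius.simps)
      also have "\<dots> = chart_sign p * (\<i> * (sgn D' * sgn (u / h\<^sup>2)))"
        by (simp add: sgn_mult chart_sign_def sgn_minus sgn_eq[of \<i>])
      finally show ?thesis .
    qed
    ultimately have T: "chart_sign p * unit_tangent f p = \<i> * sgn D' * (u * cnj h / h)"
      by (simp add: chart_sign_def)
    have 1: "?l x' * h * sphere_diff (conformal_center P f) p = D' * (\<nu> * u * cnj (sphere_diff x (Pt u)))"
      using sphere_diff_moebius[OF D, of x' "Pt u"] \<nu>(2)[OF u]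
      unfolding z unfolding p f h_def D'_def by (simp del: moebius.simps)
    have "?l x * h * sphere_diff P p = D' * sphere_diff x (Pt u)"
      using sphere_diff_moebius[OF D, of x "Pt u"] unfolding P p f h_def D'_def by (simp del: moebius.simps)
    then have 2: "cnj (sphere_diff x (Pt u)) = cnj (?l x) * cnj h * cnj (sphere_diff P p) / cnj D'"
      using D'_nz by (metis complex_cnj_mult complex_cnj_zero_iff nonzero_mult_div_cancel_left)
    have "sphere_diff (conformal_center P f) p =
        D' * (\<nu> * u * cnj (sphere_diff x (Pt u))) / (?l x' * h)"
      using 1 nz[of x'] h_nz by (simp add: field_simps)
    also have "\<dots> = \<mu> * (chart_sign p * unit_tangent f p) * cnj (sphere_diff P p)"
      unfolding 2 T \<mu>_def using D'_nz nz h_nz by (simp add: field_simps sgn_zero_iff)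
    finally show ?thesis .
  qed
  ultimately show ?thesis using that by blast
qed

section \<open>The cross-ratio of two intersecting circles\<close>

lemma intersection_angle_cis:
  assumes "is_moebius f'" "is_moebius f''" "p = circle_param f' s'" "p = circle_param f'' s''"
  shows "unit_tangent f'' p = - cis (intersection_angle f' f'' p) * unit_tangent f' p"
proof -
  let ?x = "- unit_tangent f'' p / unit_tangent f' p"
  have t: "cmod (unit_tangent f' p) = 1" "cmod (unit_tangent f'' p) = 1"
    using norm_unit_tangent[OF assms(1), of s'] norm_unit_tangent[OF assms(2), of s''] assms(3,4)
    by simp_all
  then have "cis (Arg2pi ?x) = ?x"
    using complex_norm_eq_1_exp[of ?x] by (simp add: cis_conv_exp norm_divide)
  moreover have "unit_tangent f' p \<noteq> 0" using t by auto
  ultimately show ?thesis by (simp add: intersection_angle_def)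
qed

text \<open>
  Numerator and denominator are computed from the same factors except for the tangents; replacing
  \<open>t''\<close> at \<open>p\<close> and \<open>t'\<close> at \<open>q\<close> by the other tangent at the same point brings \<open>- cis \<alpha>\<close> into the
  denominator twice.
\<close>
lemma cross_ratio_intersecting_circles:
  assumes f: "is_moebius f'" "is_moebius f''"
    and p: "p = circle_param f' s'" "p = circle_param f'' s''"
    and q: "q = circle_param f' t'" "q = circle_param f'' t''"
    and \<alpha>: "intersection_angle f' f'' p = \<alpha>" "intersection_angle f'' f' q = \<alpha>"
    and def: "cross_ratio_defined (conformal_center P f') p (conformal_center P f'') q"
  shows "cross_ratio (conformal_center P f') p (conformal_center P f'') q = Pt (cis (- (2 * \<alpha>)))"
proof -
  let ?z' = "conformal_center P f'" and ?z'' = "conformal_center P f''"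
  obtain \<mu>' where \<mu>': "\<mu>' \<noteq> 0" "\<And>t p. p = circle_param f' t \<Longrightarrow>
      sphere_diff ?z' p = \<mu>' * (chart_sign p * unit_tangent f' p) * cnj (sphere_diff P p)"
    using conformal_center_diff[OF f(1), of P] by metis
  obtain \<mu>'' where \<mu>'': "\<mu>'' \<noteq> 0" "\<And>t p. p = circle_param f'' t \<Longrightarrow>
      sphere_diff ?z'' p = \<mu>'' * (chart_sign p * unit_tangent f'' p) * cnj (sphere_diff P p)"
    using conformal_center_diff[OF f(2), of P] by metis
  define \<tau> \<sigma> where "\<tau> = unit_tangent f' p" and "\<sigma> = unit_tangent f'' q"
  have tp: "unit_tangent f'' p = - cis \<alpha> * \<tau>"
    using intersection_angle_cis[OF f p] \<alpha>(1) by (simp add: \<tau>_def)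
  have tq: "unit_tangent f' q = - cis \<alpha> * \<sigma>"
    using intersection_angle_cis[OF f(2,1) q(2,1)] \<alpha>(2) by (simp add: \<sigma>_def)
  define K where "K = \<mu>' * \<mu>'' * chart_sign p * chart_sign q * \<tau> * \<sigma> *
      cnj (sphere_diff P p) * cnj (sphere_diff P q)"
  have "cr_num ?z' p ?z'' q = sphere_diff ?z' p * sphere_diff ?z'' q"
    by (simp add: cr_num_def sphere_diff_swap[of p] sphere_diff_swap[of q])
  also have "\<dots> = K"
    by (simp add: \<mu>'(2)[OF p(1)] \<mu>''(2)[OF q(2)] \<tau>_def \<sigma>_def K_def)
  finally have num: "cr_num ?z' p ?z'' q = K" .
  have den: "cr_den ?z' p ?z'' q = (cis \<alpha>)\<^sup>2 * K"
    by (simp add: cr_den_def \<mu>''(2)[OF p(2)] \<mu>'(2)[OF q(1)] tp tq K_def power2_eq_square)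
  have "K \<noteq> 0" using def num den by (auto simp: cross_ratio_defined_def)
  moreover have "inverse ((cis \<alpha>)\<^sup>2) = cis (- (2 * \<alpha>))"
    by (rule inverse_unique) (simp add: power2_eq_square cis_mult)
  ultimately show ?thesis
    by (simp add: cross_ratio_def num den flip: inverse_eq_divide)
qed

section \<open>The hexagonal lattice\<close>

lemma eps6_Complex: "eps6 = Complex (1/2) (sqrt 3 / 2)"
proof -
  have "eps6 = cis (pi / 3)" by (simp add: eps6_def cis_conv_exp mult.commute)
  then show ?thesis by (simp add: cis.code cos_60 sin_60)
qed

lemma eps6_powers:
  "eps6 ^ 2 = eps6 - 1" "eps6 ^ 3 = - 1" "eps6 ^ 4 = - eps6"
  "eps6 ^ 5 = 1 - eps6" "eps6 ^ 6 = 1" "eps6 ^ 7 = eps6"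
proof -
  show 2: "eps6 ^ 2 = eps6 - 1"
    by (simp add: eps6_Complex power2_eq_square complex_eq_iff)
  have "eps6 ^ 3 = eps6 * eps6 ^ 2" by (simp add: power3_eq_cube power2_eq_square)
  also have "\<dots> = eps6 * (eps6 - 1)" by (simp only: 2)
  also have "\<dots> = eps6 ^ 2 - eps6" by (simp add: power2_eq_square algebra_simps)
  finally show 3: "eps6 ^ 3 = - 1" by (simp add: 2)
  show "eps6 ^ 4 = - eps6" using power_add[of eps6 3 1] 3 by simp
  show "eps6 ^ 5 = 1 - eps6" using power_add[of eps6 3 2] 3 2 by simp
  show "eps6 ^ 6 = 1" using power_add[of eps6 3 3] 3 by simp
  show "eps6 ^ 7 = eps6" using power_add[of eps6 3 4] power_add[of eps6 3 1] 3 by simp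
qed

lemma omega3_eps6: "omega3 = eps6 - 1" "omega3\<^sup>2 = - eps6"
proof -
  have *: "omega3 = eps6 ^ 2"
    by (simp add: omega3_def eps6_def exp_double[symmetric] mult.assoc)
  show "omega3 = eps6 - 1" using * eps6_powers(1) by simp
  have "omega3\<^sup>2 = eps6 ^ (2 * 2)" unfolding * power_mult ..
  then show "omega3\<^sup>2 = - eps6" using eps6_powers(3) by simp
qed

lemma norm_omega3: "cmod omega3 = 1"
  by (simp add: omega3_def)

lemma lattice_point_eps6: "lattice_point k l m = of_int (k - l) + of_int (l - m) * eps6"
  unfolding lattice_point_def omega3_eps6(2) by (simp add: omega3_eps6(1) algebra_simps)

text \<open>Labels of the same point differ by a multiple of \<open>(1, 1, 1)\<close>, so their sums agree modulo 3.\<close>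
lemma hex_vertices_not_hex_centers:
  assumes "x \<in> hex_vertices"
  shows "x \<notin> hex_centers"
proof
  assume "x \<in> hex_centers"
  then obtain k l m where x: "x = lattice_point k l m" "k + l + m = 0"
    by (auto simp: hex_centers_def)
  obtain k' l' m' where x': "x = lattice_point k' l' m'" "k' + l' + m' = 1 \<or> k' + l' + m' = - 1"
    using assms by (auto simp: hex_vertices_def)
  have "lattice_point k l m = lattice_point k' l' m'" using x x' by simp
  then have Re_Im: "Re (lattice_point k l m) = Re (lattice_point k' l' m')"
    "Im (lattice_point k l m) = Im (lattice_point k' l' m')" by simp_all
  then have "real_of_int (l - m) = real_of_int (l' - m')"
    by (simp add: lattice_point_eps6 eps6_Complex)
  moreover from this have "real_of_int (k - l) = real_of_int (k' - l')"
    using Re_Im(1) by (simp add: lattice_point_eps6 eps6_Complex)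
  ultimately have "l - m = l' - m'" "k - l = k' - l'" by linarith+
  with x(2) x'(2) show False by presburger
qed

lemma hex_edge_classI:
  assumes "u \<in> hex_vertices" "v \<in> hex_vertices"
    and "v - u = omega3 ^ (n - 1) \<or> v - u = - (omega3 ^ (n - 1))"
  shows "{u, v} \<in> hex_edge_class n"
proof -
  have "cmod (v - u) = 1" using assms(3) by (auto simp: norm_power norm_omega3)
  then have "dist u v = 1" by (simp add: dist_norm norm_minus_commute)
  then show ?thesis using assms by (auto simp: hex_edge_class_def hex_edges_def)
qed

section \<open>Adjacent circles of a hexagonal circle pattern\<close>

lemma vertex_on_circle:
  assumes "hexagonal_circle_pattern w C" "c \<in> hex_centers" "k \<in> {1..7}"
  shows "\<exists>t. w (c + eps6 ^ k) = circle_param (C c) t"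
proof -
  \<comment> \<open>The circular order lists the indices up to 6; the end of the sixth edge is the first vertex.\<close>
  define k' where "k' = (if k = 7 then 1 else k)"
  have "eps6 ^ k = eps6 ^ k'" by (simp add: k'_def eps6_powers)
  moreover have "k' \<in> {1..6}" using assms(3) by (auto simp: k'_def)
  ultimately show ?thesis
    using assms(1,2) by (fastforce simp: hexagonal_circle_pattern_def in_circular_order_def)
qed

text \<open>
  The common edge is number \<open>k\<close> of the hexagon at \<open>c\<close> and, as both hexagons are traversed
  counterclockwise, has the opposite direction to edge number \<open>j\<close> of the hexagon at \<open>c''\<close>.
  So each of its end points is the first one for one of the two hexagons.
\<close>
lemma cross_ratio_adjacent_hexagons:
  assumes pattern: "hexagonal_circle_pattern w C" and angles: "has_constant_angles w C \<alpha>"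
    and c: "c \<in> hex_centers" "c'' \<in> hex_centers"
    and ind: "k \<in> {1..6}" "j \<in> {1..6}" "n \<in> {1, 2, 3}"
    and opposite: "eps6 ^ j = - (eps6 ^ k)" and c'': "c'' = c + eps6 ^ k + eps6 ^ Suc k"
    and edge: "{c + eps6 ^ k, c + eps6 ^ Suc k} \<in> hex_edge_class n"
    and def: "cross_ratio_defined (conformal_center P (C c)) (w (c + eps6 ^ k))
        (conformal_center P (C c'')) (w (c + eps6 ^ Suc k))"
  shows "cross_ratio (conformal_center P (C c)) (w (c + eps6 ^ k))
        (conformal_center P (C c'')) (w (c + eps6 ^ Suc k)) = Pt (cis (- (2 * \<alpha> n)))"
proof -
  have j: "c'' + eps6 ^ j = c + eps6 ^ Suc k" "c'' + eps6 ^ Suc j = c + eps6 ^ k"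
    by (simp_all add: c'' opposite)
  have edges: "{c + eps6 ^ k, c + eps6 ^ Suc k} \<in> hexagon_edges c"
    "{c'' + eps6 ^ j, c'' + eps6 ^ Suc j} \<in> hexagon_edges c''"
    using ind by (auto simp: hexagon_edges_def)
  have same: "{c'' + eps6 ^ j, c'' + eps6 ^ Suc j} = {c + eps6 ^ k, c + eps6 ^ Suc k}"
    unfolding j by auto
  have "c'' - c = eps6 ^ k * (1 + eps6)" by (simp add: c'' algebra_simps)
  moreover have "eps6 \<noteq> 0" "1 + eps6 \<noteq> 0" by (simp_all add: eps6_Complex complex_eq_iff)
  ultimately have "c'' \<noteq> c" by auto
  have angle: "intersection_angle (C c1) (C c2) (w (c1 + eps6 ^ i)) = \<alpha> n"
    if "c1 \<in> hex_centers" "c2 \<in> hex_centers" "i \<in> {1..6}" "c1 \<noteq> c2"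
      "{c1 + eps6 ^ i, c1 + eps6 ^ Suc i} \<in> hexagon_edges c2 \<inter> hex_edge_class n" for c1 c2 i
    using angles that ind(3) unfolding has_constant_angles_def by blast
  have a1: "intersection_angle (C c) (C c'') (w (c + eps6 ^ k)) = \<alpha> n"
    using angle[OF c ind(1)] \<open>c'' \<noteq> c\<close> edge edges(2) same by simp
  have "intersection_angle (C c'') (C c) (w (c'' + eps6 ^ j)) = \<alpha> n"
    using angle[OF c(2,1) ind(2)] \<open>c'' \<noteq> c\<close> edge edges(1) unfolding same by simp
  then have a2: "intersection_angle (C c'') (C c) (w (c + eps6 ^ Suc k)) = \<alpha> n"
    by (simp only: j)
  have moebius: "is_moebius (C c)" "is_moebius (C c'')"
    using pattern c by (auto simp: hexagonal_circle_pattern_def)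
  obtain s' t' where "w (c + eps6 ^ k) = circle_param (C c) s'"
    "w (c + eps6 ^ Suc k) = circle_param (C c) t'"
    using vertex_on_circle[OF pattern c(1), of k] vertex_on_circle[OF pattern c(1), of "Suc k"] ind(1)
    by auto
  moreover obtain s'' t'' where "w (c'' + eps6 ^ Suc j) = circle_param (C c'') s''"
    "w (c'' + eps6 ^ j) = circle_param (C c'') t''"
    using vertex_on_circle[OF pattern c(2), of j] vertex_on_circle[OF pattern c(2), of "Suc j"] ind(2)
    by auto
  ultimately show ?thesis
    using cross_ratio_intersecting_circles[OF moebius _ _ _ _ a1 a2 def] unfolding j by blast
qed

lemma exp_divide_rcong:
  assumes "[2 * a = x - y] (rmod 2 * pi)"
  shows "exp (- (\<i> * of_real x)) / exp (- (\<i> * of_real y)) = cis (- (2 * a))"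
proof -
  obtain n :: int where n: "x - y = 2 * a + of_int n * (2 * pi)"
    using assms by (auto simp: rcong_altdef)
  have "exp (- (\<i> * of_real x)) / exp (- (\<i> * of_real y)) = cis (- (x - y))"
    by (simp add: cis_conv_exp exp_diff[symmetric] algebra_simps)
  also have "\<dots> = cis (- (2 * a)) * cis (2 * pi * of_int (- n))"
    unfolding n cis_mult by (simp add: algebra_simps)
  also have "\<dots> = cis (- (2 * a))"
    by (subst cis_multiple_2pi) simp_all
  finally show ?thesis .
qed

theorem theorem7p5:
  fixes P :: riemann_sphere
    and w :: "complex \<Rightarrow> riemann_sphere"
    and C :: "complex \<Rightarrow> riemann_sphere \<Rightarrow> riemann_sphere"
    and z :: "int \<Rightarrow> int \<Rightarrow> int \<Rightarrow> riemann_sphere"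
    and \<alpha> \<delta> :: "nat \<Rightarrow> real" and \<Delta> :: "nat \<Rightarrow> complex"
    and k l m :: int
  assumes "hexagonal_circle_pattern w C"
    and "has_constant_angles w C \<alpha>"
    and "\<And>k l m. \<bar>k + l + m\<bar> \<le> 1 \<Longrightarrow> z k l m = extended_map P w C (lattice_point k l m)"
    and "[2 * \<alpha> 1 = \<delta> 3 - \<delta> 2] (rmod 2 * pi)"
    and "[2 * \<alpha> 2 = \<delta> 1 - \<delta> 3] (rmod 2 * pi)"
    and "[2 * \<alpha> 3 = \<delta> 2 - \<delta> 1] (rmod 2 * pi)"
    and "\<And>n. n \<in> {1, 2, 3} \<Longrightarrow> \<Delta> n = exp (- (\<i> * \<delta> n))"
    and "k + l + m = 0"
  shows "(cross_ratio_defined (z k l m) (z (k+1) l m) (z (k+1) l (m-1)) (z k l (m-1)) \<longrightarrow>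
           cross_ratio (z k l m) (z (k+1) l m) (z (k+1) l (m-1)) (z k l (m-1)) = Pt (\<Delta> 1 / \<Delta> 3)) \<and>
         (cross_ratio_defined (z k l m) (z k l (m+1)) (z k (l-1) (m+1)) (z k (l-1) m) \<longrightarrow>
           cross_ratio (z k l m) (z k l (m+1)) (z k (l-1) (m+1)) (z k (l-1) m) = Pt (\<Delta> 3 / \<Delta> 2)) \<and>
         (cross_ratio_defined (z k l m) (z k (l+1) m) (z (k-1) (l+1) m) (z (k-1) l m) \<longrightarrow>
           cross_ratio (z k l m) (z k (l+1) m) (z (k-1) (l+1) m) (z (k-1) l m) = Pt (\<Delta> 2 / \<Delta> 1))"
proof -
  note pattern = assms(1) and angles = assms(2) and z = assms(3) and \<Delta> = assms(7)
    and sum = assms(8)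
  define c where "c = lattice_point k l m"
  have c: "c \<in> hex_centers" using sum by (auto simp: c_def hex_centers_def)
  have center: "z k' l' m' = conformal_center P (C (lattice_point k' l' m'))"
    "lattice_point k' l' m' \<in> hex_centers" if "k' + l' + m' = 0" for k' l' m'
  proof -
    show "lattice_point k' l' m' \<in> hex_centers" using that by (auto simp: hex_centers_def)
    then show "z k' l' m' = conformal_center P (C (lattice_point k' l' m'))"
      using z[of k' l' m'] that by (simp add: extended_map_def)
  qed
  have vertex: "z k' l' m' = w (lattice_point k' l' m')"
    "lattice_point k' l' m' \<in> hex_vertices" if "k' + l' + m' = 1 \<or> k' + l' + m' = - 1" for k' l' m'
  proof -
    show "lattice_point k' l' m' \<in> hex_vertices" using that by (auto simp: hex_vertices_def)
    then show "z k' l' m' = w (lattice_point k' l' m')"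
      using z[of k' l' m'] that hex_vertices_not_hex_centers by (auto simp: extended_map_def)
  qed
  have neighbour: "cross_ratio (z k l m) (z k1 l1 m1) (z k2 l2 m2) (z k3 l3 m3) = Pt (cis (- (2 * \<alpha> n)))"
    if "k1 + l1 + m1 = 1" "k2 + l2 + m2 = 0" "k3 + l3 + m3 = - 1"
      and lat: "lattice_point k1 l1 m1 = c + eps6 ^ i" "lattice_point k3 l3 m3 = c + eps6 ^ Suc i"
        "lattice_point k2 l2 m2 = c + eps6 ^ i + eps6 ^ Suc i"
      and ind: "i \<in> {1..6}" "j \<in> {1..6}" "n \<in> {1, 2, 3}" "eps6 ^ j = - (eps6 ^ i)"
      and diff: "eps6 ^ Suc i - eps6 ^ i = omega3 ^ (n - 1) \<or>
        eps6 ^ Suc i - eps6 ^ i = - (omega3 ^ (n - 1))"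
      and def: "cross_ratio_defined (z k l m) (z k1 l1 m1) (z k2 l2 m2) (z k3 l3 m3)"
    for k1 l1 m1 k2 l2 m2 k3 l3 m3 i j n
  proof -
    have zs: "z k l m = conformal_center P (C c)"
      "z k2 l2 m2 = conformal_center P (C (lattice_point k2 l2 m2))"
      "z k1 l1 m1 = w (c + eps6 ^ i)" "z k3 l3 m3 = w (c + eps6 ^ Suc i)"
      using center(1)[OF sum] center(1)[of k2 l2 m2] vertex(1)[of k1 l1 m1] vertex(1)[of k3 l3 m3]
        that(1-3) lat(1,2) by (simp_all add: c_def)
    have V: "c + eps6 ^ i \<in> hex_vertices" "c + eps6 ^ Suc i \<in> hex_vertices"
      using vertex(2)[of k1 l1 m1] vertex(2)[of k3 l3 m3] that(1,3) unfolding lat(1,2) by simp_all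
    have "{c + eps6 ^ i, c + eps6 ^ Suc i} \<in> hex_edge_class n"
      by (rule hex_edge_classI[OF V]) (use diff in simp)
    from cross_ratio_adjacent_hexagons[OF pattern angles c center(2)[OF that(2)] ind lat(3) this,
        of P]
    show ?thesis using def unfolding zs by blast
  qed
  \<comment> \<open>The common edges are numbers 6, 4 and 2 of the hexagon at \<open>c\<close>.\<close>
  have "cross_ratio (z k l m) (z (k+1) l m) (z (k+1) l (m-1)) (z k l (m-1)) = Pt (\<Delta> 1 / \<Delta> 3)"
    if "cross_ratio_defined (z k l m) (z (k+1) l m) (z (k+1) l (m-1)) (z k l (m-1))"
    using neighbour[of "k+1" l m "k+1" l "m-1" k l "m-1" 6 3 2] that sum
      exp_divide_rcong[OF assms(5)]
    by (simp add: \<Delta> c_def lattice_point_eps6 eps6_powers omega3_eps6 algebra_simps del: power_Suc)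
  moreover have "cross_ratio (z k l m) (z k l (m+1)) (z k (l-1) (m+1)) (z k (l-1) m) = Pt (\<Delta> 3 / \<Delta> 2)"
    if "cross_ratio_defined (z k l m) (z k l (m+1)) (z k (l-1) (m+1)) (z k (l-1) m)"
    using neighbour[of k l "m+1" k "l-1" "m+1" k "l-1" m 4 1 1] that sum
      exp_divide_rcong[OF assms(4)]
    by (simp add: \<Delta> c_def lattice_point_eps6 eps6_powers omega3_eps6 algebra_simps del: power_Suc)
  moreover have "cross_ratio (z k l m) (z k (l+1) m) (z (k-1) (l+1) m) (z (k-1) l m) = Pt (\<Delta> 2 / \<Delta> 1)"
    if "cross_ratio_defined (z k l m) (z k (l+1) m) (z (k-1) (l+1) m) (z (k-1) l m)"
    using neighbour[of k "l+1" m "k-1" "l+1" m "k-1" l m 2 5 3] that sum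
      exp_divide_rcong[OF assms(6)]
    by (simp add: \<Delta> c_def lattice_point_eps6 eps6_powers omega3_eps6
        omega3_eps6(2)[unfolded omega3_eps6(1)] algebra_simps del: power_Suc)
  ultimately show ?thesis by blast
qed

end
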